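(* Let $C\subseteq\mathbb{F}_2^n$ be a binary linear code, $g\ge1$, let $X_1,\dots,X_\ell$ be pairwise disjoint sets with $[n]=X_1\sqcup\cdots\sqcup X_\ell$, and let $T_i\subseteq X_i$ for $1\le i\le\ell$. Then \begin{align*} J^{(g)}_{C^\perp,X_1(T_1),\dots,X_\ell(T_\ell)}&(\{\{y_{i,a},x_{i,a}\}_{a\in\mathbb{F}_2^g}\}_{1\le i\le\ell})\\ &=\frac{1}{|C|^g}J^{(g)}_{C,X_1(T_1),\dots,X_\ell(T_\ell)}\left(\left\{\left\{\sum_{b\in\mathbb{F}_2^g}(-1)^{a\cdot b}y_{i,b},\ \sum_{b\in\mathbb{F}_2^g}(-1)^{a\cdot b}x_{i,b}\right\}_{a\in\mathbb{F}_2^g}\right\}_{1\le i\le\ell}\right), \end{align*} where on the right-hand side $y_{i,a}$ is replaced by $\sum_b(-1)^{a\cdot b}y_{i,b}$ and $x_{i,a}$ by $\sum_b(-1)^{a\cdot b}x_{i,b}$.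
   Context: $[n]=\{1,\dots,n\}$; $C^\perp=\{v\in\mathbb{F}_2^n: u\cdot v=0\ \forall u\in C\}$ with $u\cdot v=\sum_k u_kv_k$; for $a,b\in\mathbb{F}_2^g$, $a\cdot b$ is the standard inner product. For $u_1,\dots,u_g\in\mathbb{F}_2^n$, $a\in\mathbb{F}_2^g$ and $X\subseteq[n]$, let $n_{a,X}(u_1,\dots,u_g)$ be the number of $k\in X$ with $(u_{1k},\dots,u_{gk})=a$. The $g$-th split Jacobi polynomial of a code $D$ attached to $T_1\subseteq X_1,\dots,T_\ell\subseteq X_\ell$ is the polynomial in the variables $y_{i,a},x_{i,a}$ ($1\le i\le\ell$, $a\in\mathbb{F}_2^g$) \[J^{(g)}_{D,X_1(T_1),\dots,X_\ell(T_\ell)}=\sum_{u_1,\dots,u_g\in D}\prod_{a\in\mathbb{F}_2^g}\prod_{i=1}^{\ell}y_{i,a}^{n_{a,T_i}(u_1,\dots,u_g)}x_{i,a}^{n_{a,X_i\setminus T_i}(u_1,\dots,u_g)}.\] *)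

theory Defs
  imports "HOL-Analysis.Analysis" "HOL-Library.Poly_Mapping" "HOL-Library.Z2"
begin

instance bit :: finite
proof
  have "(UNIV :: bit set) = {0, 1}"
    using bit.exhaust by auto
  then show "finite (UNIV :: bit set)"
    by (metis finite.emptyI finite.insertI)
qed

definition dual_code :: "(bit ^ 'n) set \<Rightarrow> (bit ^ 'n) set" where
  "dual_code C = {v. \<forall>u\<in>C. scalar_product u v = 0}"

text \<open>Multivariate polynomials in variables of type \<open>'v\<close> are realised as the monoid algebra of the
  free commutative monoid on \<open>'v\<close>: a monomial is a finitely supported exponent function, and
  multiplication on \<^type>\<open>poly_mapping\<close> is convolution.\<close>

type_synonym ('v, 'k) mvpoly = "('v \<Rightarrow>\<^sub>0 nat) \<Rightarrow>\<^sub>0 'k"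

definition Var :: "'v \<Rightarrow> ('v, 'k::comm_semiring_1) mvpoly" where
  "Var v = Poly_Mapping.single (Poly_Mapping.single v 1) 1"

definition Const :: "'k::comm_semiring_1 \<Rightarrow> ('v, 'k) mvpoly" where
  "Const c = Poly_Mapping.single 0 c"

text \<open>Simultaneous substitution of the polynomial \<open>\<sigma> v\<close> for every variable \<open>v\<close>.\<close>

definition subst_poly ::
    "('v \<Rightarrow> ('w, 'k) mvpoly) \<Rightarrow> ('v, 'k::comm_semiring_1) mvpoly \<Rightarrow> ('w, 'k) mvpoly" where
  "subst_poly \<sigma> p =
    (\<Sum>m\<in>Poly_Mapping.keys p.
      Const (Poly_Mapping.lookup p m) *
        (\<Prod>v\<in>Poly_Mapping.keys m. \<sigma> v ^ Poly_Mapping.lookup m v))"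

text \<open>The variables \<open>y\<^bsub>i,a\<^esub>\<close> and \<open>x\<^bsub>i,a\<^esub>\<close>; the parameter \<open>'a\<close> will be \<open>bit ^ 'g\<close>.\<close>

datatype 'a split_var = yvar nat 'a | xvar nat 'a

text \<open>A tuple \<open>(u\<^sub>1, \<dots>, u\<^sub>g)\<close> of vectors of length \<open>n\<close> is the \<open>g \<times> n\<close> matrix \<open>u\<close> with these rows,
  so that \<open>(u\<^bsub>1k\<^esub>, \<dots>, u\<^bsub>gk\<^esub>)\<close> is its \<open>k\<close>-th column.\<close>

definition col_count :: "bit ^ 'g \<Rightarrow> 'n set \<Rightarrow> bit ^ 'n ^ 'g \<Rightarrow> nat" where
  "col_count a S u = card {k \<in> S. column k u = a}"

definition split_jacobi ::
    "(bit ^ 'n) set \<Rightarrow> nat \<Rightarrow> (nat \<Rightarrow> 'n set) \<Rightarrow> (nat \<Rightarrow> 'n set)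
      \<Rightarrow> ((bit ^ 'g) split_var, 'k::comm_semiring_1) mvpoly" where
  "split_jacobi D l X T =
    (\<Sum>u \<in> {u :: bit ^ 'n ^ 'g. \<forall>j. u $ j \<in> D}.
      \<Prod>a\<in>UNIV. \<Prod>i=1..l.
        Var (yvar i a) ^ col_count a (T i) u * Var (xvar i a) ^ col_count a (X i - T i) u)"

end

theory Submission
  imports Defs
begin

text \<open>Each summand of the Jacobi polynomial is a product over the coordinates \<open>k\<close> of one variable
  depending on \<open>k\<close> and on the \<open>k\<close>-th column. After the substitution, expanding this product of sums
  produces a sum over all \<open>g\<close>-tuples \<open>v\<close> of vectors, weighted by
  \<open>\<Prod>j. \<Sum>w\<in>C. (-1)\<^bsup>w \<cdot> v\<^sub>j\<^esup>\<close>. Orthogonality of characters evaluates this weight to \<open>|C|\<^sup>g\<close> if all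
  \<open>v\<^sub>j\<close> lie in the dual code, and to \<open>0\<close> otherwise.\<close>

section \<open>Substitution is a ring homomorphism\<close>

text \<open>The inner product of \<open>subst_poly\<close>, isolated because it is a homomorphism
  from the additive monoid of exponents to the multiplicative monoid of the target.\<close>

definition subst_monom :: "('v \<Rightarrow> 'r) \<Rightarrow> ('v \<Rightarrow>\<^sub>0 nat) \<Rightarrow> 'r::comm_semiring_1" where
  "subst_monom \<sigma> m = (\<Prod>v\<in>Poly_Mapping.keys m. \<sigma> v ^ Poly_Mapping.lookup m v)"

text \<open>Variables outside the support have exponent 0 and contribute the factor 1, so monomials
  with different supports can be compared over one index set.\<close>

lemma subst_monom_superset:
  assumes "finite A" "Poly_Mapping.keys m \<subseteq> A"
  shows "subst_monom \<sigma> m = (\<Prod>v\<in>A. \<sigma> v ^ Poly_Mapping.lookup m v)"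
  unfolding subst_monom_def using assms
  by (intro prod.mono_neutral_left) (auto simp: in_keys_iff)

lemma subst_monom_0 [simp]: "subst_monom \<sigma> 0 = 1"
  by (simp add: subst_monom_def)

lemma subst_monom_single [simp]: "subst_monom \<sigma> (Poly_Mapping.single v n) = \<sigma> v ^ n"
  by (simp add: subst_monom_def)

lemma subst_monom_add: "subst_monom \<sigma> (m + m') = subst_monom \<sigma> m * subst_monom \<sigma> m'"
proof -
  let ?A = "Poly_Mapping.keys m \<union> Poly_Mapping.keys m'"
  have "Poly_Mapping.keys (m + m') \<subseteq> ?A"
    by (rule Poly_Mapping.keys_add)
  then show ?thesis
    by (simp add: subst_monom_superset[of ?A] lookup_add power_add prod.distrib)
qed

lemma Const_0 [simp]: "Const 0 = 0"
  by (simp add: Const_def)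

lemma Const_1 [simp]: "Const 1 = 1"
  by (simp add: Const_def)

lemma Const_add: "Const (c + d) = Const c + Const d"
  by (simp add: Const_def single_add)

lemma Const_mult: "Const (c * d) = Const c * Const d"
  by (simp add: Const_def mult_single)

lemma Const_of_nat: "Const (of_nat n) = of_nat n"
  by (induction n) (simp_all add: Const_add)

lemma subst_poly_superset:
  assumes "finite A" "Poly_Mapping.keys p \<subseteq> A"
  shows "subst_poly \<sigma> p = (\<Sum>m\<in>A. Const (Poly_Mapping.lookup p m) * subst_monom \<sigma> m)"
  unfolding subst_poly_def subst_monom_def[symmetric] using assms
  by (intro sum.mono_neutral_left) (auto simp: in_keys_iff)

lemma subst_poly_0 [simp]: "subst_poly \<sigma> 0 = 0"
  by (simp add: subst_poly_def)

lemma subst_poly_add: "subst_poly \<sigma> (p + q) = subst_poly \<sigma> p + subst_poly \<sigma> q"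
proof -
  let ?A = "Poly_Mapping.keys p \<union> Poly_Mapping.keys q"
  have "Poly_Mapping.keys (p + q) \<subseteq> ?A"
    by (rule Poly_Mapping.keys_add)
  then show ?thesis
    by (simp add: subst_poly_superset[of ?A] lookup_add Const_add distrib_right sum.distrib)
qed

lemma subst_poly_sum: "subst_poly \<sigma> (\<Sum>i\<in>I. p i) = (\<Sum>i\<in>I. subst_poly \<sigma> (p i))"
  by (induction I rule: infinite_finite_induct) (simp_all add: subst_poly_add)

lemma subst_poly_single:
  "subst_poly \<sigma> (Poly_Mapping.single m c) = Const c * subst_monom \<sigma> m"
  by (cases "c = 0") (simp_all add: subst_poly_def subst_monom_def)

lemma subst_poly_1 [simp]: "subst_poly \<sigma> 1 = 1"
  using subst_poly_single[of \<sigma> 0 1] by simp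

lemma subst_poly_Var [simp]: "subst_poly \<sigma> (Var v) = \<sigma> v"
  by (simp add: Var_def subst_poly_single)

lemma poly_mapping_sum_single:
  "p = (\<Sum>m\<in>Poly_Mapping.keys p. Poly_Mapping.single m (Poly_Mapping.lookup p m))"
  by (rule poly_mapping_eqI) (auto simp: lookup_sum lookup_single when_def in_keys_iff)

text \<open>By additivity it suffices to multiply single terms, where exponents add and coefficients
  multiply.\<close>

lemma subst_poly_mult: "subst_poly \<sigma> (p * q) = subst_poly \<sigma> p * subst_poly \<sigma> q"
proof -
  let ?s = "\<lambda>p m. Poly_Mapping.single m (Poly_Mapping.lookup p m)"
  have "p * q = (\<Sum>m\<in>Poly_Mapping.keys p. ?s p m) * (\<Sum>m'\<in>Poly_Mapping.keys q. ?s q m')"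
    by (simp flip: poly_mapping_sum_single)
  then have "subst_poly \<sigma> (p * q) = (\<Sum>m\<in>Poly_Mapping.keys p. \<Sum>m'\<in>Poly_Mapping.keys q.
      subst_poly \<sigma> (?s p m * ?s q m'))"
    by (simp add: sum_product subst_poly_sum)
  also have "\<dots> = subst_poly \<sigma> p * subst_poly \<sigma> q"
    by (simp only: mult_single subst_poly_single subst_monom_add Const_mult sum_product mult_ac
        subst_poly_superset[OF finite_keys order_refl, of _ p]
        subst_poly_superset[OF finite_keys order_refl, of _ q])
  finally show ?thesis .
qed

lemma subst_poly_prod: "subst_poly \<sigma> (\<Prod>i\<in>I. p i) = (\<Prod>i\<in>I. subst_poly \<sigma> (p i))"
  by (induction I rule: infinite_finite_induct) (simp_all add: subst_poly_mult)

section \<open>Characters of binary codes\<close>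

text \<open>The sign character of the additive group of \<open>bit\<close>, with values in any ring
  so that it can be used inside polynomial rings.\<close>

definition bit_sign :: "bit \<Rightarrow> 'r::ring_1" where
  "bit_sign x = (-1) ^ of_bit x"

lemma bit_sign_0 [simp]: "bit_sign 0 = 1" and bit_sign_1 [simp]: "bit_sign 1 = -1"
  by (simp_all add: bit_sign_def)

lemma bit_sign_add: "bit_sign (x + y) = bit_sign x * bit_sign y"
  by (cases x; cases y) simp_all

lemma bit_sign_sum: "bit_sign (\<Sum>i\<in>I. f i) = (\<Prod>i\<in>I. bit_sign (f i) :: 'r::comm_ring_1)"
  by (induction I rule: infinite_finite_induct) (simp_all only: bit_sign_add bit_sign_0 sum.infinite prod.infinite sum.empty prod.empty
      sum.insert prod.insert not_False_eq_True)

text \<open>Carries a character sum evaluated over the integers to an arbitrary ring.\<close>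

lemma of_int_bit_sign: "of_int (bit_sign x) = bit_sign x"
  by (cases x) simp_all

lemma scalar_product_add_left:
  "scalar_product (u + v) w = scalar_product u w + scalar_product v w"
  by (simp add: scalar_product_def distrib_right sum.distrib)

text \<open>If some \<open>w\<^sub>0\<close> in \<open>C\<close> is not orthogonal to
  \<open>v\<close>, translation by \<open>w\<^sub>0\<close> permutes \<open>C\<close> and flips
  every sign, so the sum equals its own negative.\<close>

lemma sum_bit_sign_subspace:
  fixes C :: "(bit ^ 'n) set"
  assumes "vec.subspace C"
  shows "(\<Sum>w\<in>C. bit_sign (scalar_product w v) :: 'r::ring_1) =
    (if v \<in> dual_code C then of_nat (card C) else 0)"
proof (cases "v \<in> dual_code C")
  case True
  then show ?thesis
    by (simp add: dual_code_def)
next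
  case False
  then obtain w\<^sub>0 where w\<^sub>0: "w\<^sub>0 \<in> C" "scalar_product w\<^sub>0 v = 1"
    by (auto simp: dual_code_def)
  txt \<open>The sum is evaluated in \<^typ>\<open>int\<close>, because \<open>S = - S\<close> need not imply \<open>S = 0\<close> in \<open>'r\<close>.\<close>
  let ?S = "\<Sum>w\<in>C. bit_sign (scalar_product w v) :: int"
  \<comment> \<open>In characteristic 2 the translation is its own inverse.\<close>
  have "w + w\<^sub>0 + w\<^sub>0 = w" for w
    by (simp add: vec_eq_iff add.assoc)
  then have "bij_betw (\<lambda>w. w + w\<^sub>0) C C"
    using vec.subspace_add[OF assms] w\<^sub>0
    by (intro bij_betwI[where g = "\<lambda>w. w + w\<^sub>0"]) auto
  then have "?S = (\<Sum>w\<in>C. bit_sign (scalar_product (w + w\<^sub>0) v))"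
    by (rule sum.reindex_bij_betw[symmetric])
  also have "\<dots> = - ?S"
    by (simp only: scalar_product_add_left bit_sign_add w\<^sub>0 bit_sign_1 sum_negf mult_minus1_right)
  finally have "?S = 0"
    by simp
  then have "of_int ?S = (0::'r)"
    by simp
  then show ?thesis
    using False by (simp add: of_int_bit_sign)
qed

lemma bij_betw_vec_nth:
  "bij_betw (($) :: 'a ^ 'n \<Rightarrow> _) {u. \<forall>j. u $ j \<in> D} (PiE UNIV (\<lambda>_. D))"
  by (rule bij_betwI[where g = vec_lambda]) auto

text \<open>A free choice of one column per coordinate is the same as a choice of matrix; this turns
  the choice functions of an expanded product into tuples of vectors.\<close>

lemma bij_column: "bij (\<lambda>(u :: 'a ^ 'n ^ 'g) k. column k u)"
  by (rule bij_betwI[where g = "\<lambda>f. \<chi> j k. f k $ j"]) (auto simp: column_def vec_eq_iff)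

text \<open>The entrywise products of two matrices can be summed by rows instead of columns. The
  rows of \<open>u\<close> vary independently in \<open>C\<close>, so the sum factors into one
  character sum per row.\<close>

lemma sum_tuples_bit_sign:
  fixes C :: "(bit ^ 'n) set" and v :: "bit ^ 'n ^ 'g"
  assumes "vec.subspace C"
  shows "(\<Sum>u | \<forall>j. u $ j \<in> C.
      \<Prod>k\<in>UNIV. bit_sign (scalar_product (column k u) (column k v)) :: 'r::comm_ring_1) =
    (if \<forall>j. v $ j \<in> dual_code C then of_nat (card C) ^ CARD('g) else 0)"
proof -
  have "(\<Prod>k\<in>UNIV. bit_sign (scalar_product (column k u) (column k v)) :: 'r) =
      (\<Prod>j\<in>UNIV. bit_sign (scalar_product (u $ j) (v $ j)))" for u
    unfolding scalar_product_def bit_sign_sum by (subst prod.swap) (simp add: column_def)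
  then have "(\<Sum>u | \<forall>j. u $ j \<in> C.
      \<Prod>k\<in>UNIV. bit_sign (scalar_product (column k u) (column k v)) :: 'r) =
      (\<Sum>u | \<forall>j. u $ j \<in> C. \<Prod>j\<in>UNIV. bit_sign (scalar_product (u $ j) (v $ j)))"
    by simp
  also have "\<dots> = (\<Sum>f\<in>PiE UNIV (\<lambda>_. C). \<Prod>j\<in>UNIV. bit_sign (scalar_product (f j) (v $ j)))"
    by (rule sum.reindex_bij_betw[OF bij_betw_vec_nth])
  also have "\<dots> = (\<Prod>j\<in>UNIV. \<Sum>w\<in>C. bit_sign (scalar_product w (v $ j)))"
    by (rule prod_sum_PiE[symmetric]) auto
  also have "\<dots> = (\<Prod>j\<in>UNIV. if v $ j \<in> dual_code C then of_nat (card C) else 0)"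
    by (simp add: sum_bit_sign_subspace[OF assms])
  also have "\<dots> = (if \<forall>j. v $ j \<in> dual_code C then of_nat (card C) ^ CARD('g) else 0)"
    \<comment> \<open>A single row of \<open>v\<close> outside the dual code gives a zero
      factor.\<close>
    by (cases "\<forall>j. v $ j \<in> dual_code C") (simp, subst prod_zero, auto)
  finally show ?thesis .
qed

text \<open>The MacWilliams identity with an arbitrary weight function in every coordinate.\<close>

lemma macwilliams_columns:
  fixes C :: "(bit ^ 'n) set" and f :: "'n \<Rightarrow> bit ^ 'g \<Rightarrow> 'r::comm_ring_1"
  assumes "vec.subspace C"
  shows "(\<Sum>u | \<forall>j. u $ j \<in> C.
      \<Prod>k\<in>UNIV. \<Sum>b\<in>UNIV. bit_sign (scalar_product (column k u) b) * f k b) =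
    of_nat (card C) ^ CARD('g) *
      (\<Sum>v | \<forall>j. v $ j \<in> dual_code C. \<Prod>k\<in>UNIV. f k (column k v))"
proof -
  have "(\<Prod>k\<in>UNIV. \<Sum>b\<in>UNIV. bit_sign (scalar_product (column k u) b) * f k b) =
      (\<Sum>v\<in>UNIV. \<Prod>k\<in>UNIV. bit_sign (scalar_product (column k u) (column k v)) * f k (column k v))"
    for u :: "bit ^ 'n ^ 'g"
    by (subst prod_sum_PiE) (simp_all add: sum.reindex_bij_betw[OF bij_column, symmetric])
  then have "(\<Sum>u | \<forall>j. u $ j \<in> C.
      \<Prod>k\<in>UNIV. \<Sum>b\<in>UNIV. bit_sign (scalar_product (column k u) b) * f k b) =
      (\<Sum>v\<in>UNIV. (\<Sum>u | \<forall>j. u $ j \<in> C.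
        \<Prod>k\<in>UNIV. bit_sign (scalar_product (column k u) (column k v))) *
          (\<Prod>k\<in>UNIV. f k (column k v)))"
    by (simp add: prod.distrib sum_distrib_right) (rule sum.swap)
  also have "\<dots> = (\<Sum>v\<in>UNIV. if \<forall>j. v $ j \<in> dual_code C
      then of_nat (card C) ^ CARD('g) * (\<Prod>k\<in>UNIV. f k (column k v)) else 0)"
    by (intro sum.cong refl) (simp add: sum_tuples_bit_sign[OF assms])
  also have "\<dots> = of_nat (card C) ^ CARD('g) *
      (\<Sum>v | \<forall>j. v $ j \<in> dual_code C. \<Prod>k\<in>UNIV. f k (column k v))"
    by (simp add: sum.If_cases sum_distrib_left)
  finally show ?thesis .
qed

section \<open>Split Jacobi polynomials\<close>

text \<open>Left unapplied to a column: block and kind of variable depend on \<open>k\<close> alone,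
  and the substitution changes only the second index. The \<open>THE\<close> picks the block
  containing \<open>k\<close>, unique when the blocks partition the coordinates.\<close>

definition coord_var ::
    "nat \<Rightarrow> (nat \<Rightarrow> 'n set) \<Rightarrow> (nat \<Rightarrow> 'n set) \<Rightarrow> 'n \<Rightarrow> 'a \<Rightarrow> 'a split_var" where
  "coord_var l X T k =
    (let i = (THE i. i \<in> {1..l} \<and> k \<in> X i) in if k \<in> T i then yvar i else xvar i)"

lemma coord_var_eq:
  assumes "disjoint_family_on X {1..l}" "i \<in> {1..l}" "k \<in> X i"
  shows "coord_var l X T k = (if k \<in> T i then yvar i else xvar i)"
proof -
  have "(THE i. i \<in> {1..l} \<and> k \<in> X i) = i"
    using assms by (intro the_equality) (auto dest: disjoint_family_onD)
  then show ?thesis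
    by (simp add: coord_var_def)
qed

text \<open>Coordinates with equal columns contribute equal factors, so grouping by column value
  yields the exponents \<open>col_count\<close>.\<close>

lemma prod_columns_eq_prod_power:
  fixes u :: "bit ^ 'n ^ 'g" and f :: "bit ^ 'g \<Rightarrow> 'r::comm_monoid_mult"
  shows "(\<Prod>k\<in>S. f (column k u)) = (\<Prod>a\<in>UNIV. f a ^ col_count a S u)"
proof -
  have "(\<Prod>a\<in>UNIV. f a ^ col_count a S u) =
      (\<Prod>a\<in>UNIV. \<Prod>k\<in>{k \<in> S. column k u = a}. f (column k u))"
    by (simp add: col_count_def)
  also have "\<dots> = (\<Prod>k\<in>S. f (column k u))"
    by (rule prod.group) auto
  finally show ?thesis
    by simp
qed

text \<open>Brings the polynomial into the coordinatewise form required by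
  \<open>macwilliams_columns\<close>: the coordinates are split into blocks, each block into
  \<open>T i\<close> and its complement, and each piece is grouped by column.\<close>

lemma split_jacobi_eq_prod_columns:
  fixes D :: "(bit ^ 'n) set"
  assumes X: "disjoint_family_on X {1..l}" "(\<Union>i\<in>{1..l}. X i) = UNIV"
    and T: "\<And>i. i \<in> {1..l} \<Longrightarrow> T i \<subseteq> X i"
  shows "(split_jacobi D l X T :: ((bit ^ 'g) split_var, 'k::comm_semiring_1) mvpoly) =
    (\<Sum>u | \<forall>j. u $ j \<in> D. \<Prod>k\<in>UNIV. Var (coord_var l X T k (column k u)))"
proof -
  have "(\<Prod>k\<in>UNIV. Var (coord_var l X T k (column k u)) :: (_, 'k) mvpoly) =
      (\<Prod>a\<in>UNIV. \<Prod>i=1..l.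
        Var (yvar i a) ^ col_count a (T i) u * Var (xvar i a) ^ col_count a (X i - T i) u)"
    for u :: "bit ^ 'n ^ 'g"
  proof -
    let ?f = "\<lambda>k. Var (coord_var l X T k (column k u)) :: (_, 'k) mvpoly"
    have "(\<Prod>k\<in>UNIV. ?f k) = (\<Prod>i=1..l. \<Prod>k\<in>X i. ?f k)"
      unfolding X(2)[symmetric] using X(1)
      by (intro prod.UNION_disjoint) (auto simp: disjoint_family_on_def)
    also have "\<dots> = (\<Prod>i=1..l. (\<Prod>k\<in>T i. Var (yvar i (column k u))) *
        (\<Prod>k\<in>X i - T i. Var (xvar i (column k u))))"
    proof (rule prod.cong[OF refl])
      fix i assume i: "i \<in> {1..l}"
      have "(\<Prod>k\<in>X i. ?f k) = (\<Prod>k\<in>T i. ?f k) * (\<Prod>k\<in>X i - T i. ?f k)"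
        by (subst prod.subset_diff[OF T[OF i]]) (simp_all add: mult.commute)
      also have "(\<Prod>k\<in>T i. ?f k) = (\<Prod>k\<in>T i. Var (yvar i (column k u)))"
        using T[OF i] by (intro prod.cong refl) (auto simp: coord_var_eq[OF X(1) i])
      also have "(\<Prod>k\<in>X i - T i. ?f k) = (\<Prod>k\<in>X i - T i. Var (xvar i (column k u)))"
        by (intro prod.cong refl) (auto simp: coord_var_eq[OF X(1) i])
      finally show "(\<Prod>k\<in>X i. ?f k) = (\<Prod>k\<in>T i. Var (yvar i (column k u))) *
        (\<Prod>k\<in>X i - T i. Var (xvar i (column k u)))" .
    qed
    also have "\<dots> = (\<Prod>i=1..l. \<Prod>a\<in>UNIV.
        Var (yvar i a) ^ col_count a (T i) u * Var (xvar i a) ^ col_count a (X i - T i) u)"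
      by (simp add: prod.distrib
          prod_columns_eq_prod_power[where f = "\<lambda>a. Var (yvar _ a)"]
          prod_columns_eq_prod_power[where f = "\<lambda>a. Var (xvar _ a)"])
    finally show ?thesis
      by (subst prod.swap)
  qed
  then show ?thesis
    by (simp add: split_jacobi_def)
qed

theorem theorem4p6:
  fixes C :: "(bit ^ 'n) set"
    and l :: nat
    and X T :: "nat \<Rightarrow> 'n set"
  assumes "vec.subspace C"
    and "disjoint_family_on X {1..l}"
    and "(\<Union>i\<in>{1..l}. X i) = UNIV"
    and "\<And>i. i \<in> {1..l} \<Longrightarrow> T i \<subseteq> X i"
  shows "(split_jacobi (dual_code C) l X T :: ((bit ^ 'g) split_var, 'k::field_char_0) mvpoly) =
    Const (1 / of_nat (card C) ^ CARD('g)) *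
      subst_poly
        (\<lambda>v. case v of
            yvar i a \<Rightarrow> \<Sum>b\<in>UNIV. (-1) ^ of_bit (scalar_product a b) * Var (yvar i b)
          | xvar i a \<Rightarrow> \<Sum>b\<in>UNIV. (-1) ^ of_bit (scalar_product a b) * Var (xvar i b))
        (split_jacobi C l X T :: ((bit ^ 'g) split_var, 'k) mvpoly)"
    (is "_ = _ * subst_poly ?\<sigma> _")
proof -
  let ?J = "\<lambda>D. split_jacobi D l X T :: ((bit ^ 'g) split_var, 'k) mvpoly"
  let ?N = "of_nat (card C) ^ CARD('g)"
  note expand = split_jacobi_eq_prod_columns[OF assms(2-4)]
  \<comment> \<open>Both kinds of variable are transformed by the same character kernel, so no case
    distinction survives.\<close>
  have "?\<sigma> (coord_var l X T k a) =
      (\<Sum>b\<in>UNIV. bit_sign (scalar_product a b) * Var (coord_var l X T k b))" for k a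
    by (simp add: coord_var_def Let_def bit_sign_def)
  then have "subst_poly ?\<sigma> (?J C) = (\<Sum>u | \<forall>j. u $ j \<in> C. \<Prod>k\<in>UNIV. \<Sum>b\<in>UNIV.
      bit_sign (scalar_product (column k u) b) * Var (coord_var l X T k b))"
    by (simp only: expand subst_poly_sum subst_poly_prod subst_poly_Var)
  also have "\<dots> = ?N * ?J (dual_code C)"
    by (simp only: macwilliams_columns[OF assms(1)] expand)
  \<comment> \<open>Here \<open>?N\<close> is a polynomial; as a constant polynomial it can be
    cancelled against \<open>1 / ?N\<close> in the coefficient field.\<close>
  also have "?N = Const (of_nat (card C) ^ CARD('g))"
    by (simp only: Const_of_nat flip: of_nat_power)
  finally have "Const (1 / ?N) * subst_poly ?\<sigma> (?J C) = Const (1 / ?N * ?N) * ?J (dual_code C)"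
    by (simp only: Const_mult mult.assoc)
  \<comment> \<open>With characteristic 0 this makes \<open>?N\<close> invertible in
    \<open>'k\<close>.\<close>
  moreover have "card C \<noteq> 0"
    using vec.subspace_0[OF assms(1)] by auto
  ultimately show ?thesis
    by simp
qed

end
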